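(* Let $A=A^*$ be a selfadjoint linear operator on the $n$-dimensional Euclidean space $\mathbb{C}^n$, let $f\in R(A)$, and let $y$ be the minimal-norm solution of the linear system $Au=f$. For each $a>0$ let $u_a:[0,\infty)\to\mathbb{C}^n$ be the unique solution of the Cauchy problem $$\dot u_a(t)=i(A+iaI)u_a(t)+f,\qquad u_a(0)=0 .$$ Then $$-i\lim_{a\to 0}\lim_{t\to\infty}u_a(t)=y .$$
   Context: $R(A)$ denotes the range of $A$, $I$ is the identity operator, $i$ is the imaginary unit, and $\dot u=du/dt$. $A$ is allowed to be singular. Let $N=\{u: Au=0\}$ be the null-space of $A$. The minimal-norm solution $y$ of $Au=f$ is the unique solution that is orthogonal to $N$. The limit $a\to 0$ is taken over $a>0$; the inner limit $t\to\infty$ is taken first, for fixed $a>0$. *)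

theory Defs
  imports "HOL-Analysis.Analysis"
begin

text \<open>The inner product of the library on \<^typ>\<open>complex ^ 'n\<close> is the real part of the Hermitian
  one, so the Hermitian inner product is introduced here; it induces the library's norm.\<close>

definition cinner :: "complex ^ 'n \<Rightarrow> complex ^ 'n \<Rightarrow> complex"
  where "cinner x y = (\<Sum>j\<in>UNIV. x $ j * cnj (y $ j))"

lemma cinner_self: "cinner x x = of_real ((norm x)\<^sup>2)"
  by (simp add: cinner_def norm_vec_def L2_set_def sum_nonneg complex_norm_square flip: of_real_power)

text \<open>Linearity is over \<open>\<complex>\<close> (with respect to \<open>*s\<close>), not merely over \<open>\<real>\<close>.\<close>

definition selfadjoint :: "(complex ^ 'n \<Rightarrow> complex ^ 'n) \<Rightarrow> bool"
  where "selfadjoint A \<longleftrightarrow>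
    Vector_Spaces.linear (*s) (*s) A \<and> (\<forall>x y. cinner (A x) y = cinner x (A y))"

definition null_space :: "(complex ^ 'n \<Rightarrow> complex ^ 'n) \<Rightarrow> (complex ^ 'n) set"
  where "null_space A = {u. A u = 0}"

definition minimal_norm_solution ::
    "(complex ^ 'n \<Rightarrow> complex ^ 'n) \<Rightarrow> complex ^ 'n \<Rightarrow> complex ^ 'n \<Rightarrow> bool"
  where "minimal_norm_solution A f y \<longleftrightarrow>
    A y = f \<and> (\<forall>z\<in>null_space A. cinner y z = 0)"

text \<open>Only the values on \<open>[0, \<infinity>)\<close> matter; the derivative at \<open>0\<close> is one-sided.\<close>

definition cauchy_solution ::
    "(complex ^ 'n \<Rightarrow> complex ^ 'n) \<Rightarrow> complex ^ 'n \<Rightarrow> real \<Rightarrow> (real \<Rightarrow> complex ^ 'n) \<Rightarrow> bool"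
  where "cauchy_solution A f a u \<longleftrightarrow>
    u 0 = 0 \<and>
    (\<forall>t\<ge>0. (u has_vector_derivative
        (\<i> *s (A (u t) + (\<i> * of_real a) *s u t) + f)) (at t within {0..}))"

end

theory Submission
  imports Defs
begin

text \<open>A stationary point \<open>w\<close> of the flow satisfies \<open>(A + \<i>a) w = \<i> f\<close>, so that \<open>x = - \<i> w\<close> solves the
  regularized equation \<open>(A + \<i>a) x = f\<close>. The estimates rest on one fact about a selfadjoint \<open>A\<close>:
  \<open>A x\<close> is orthogonal to \<open>\<i> x\<close> for the real inner product
  (lemma \<open>selfadjoint_inner_imaginary\<close>). It is used three times.

  First, \<open>a \<parallel>x\<parallel> \<le> \<parallel>(A + \<i>a) x\<parallel>\<close> by Pythagoras, so \<open>A + \<i>a\<close> is injective, hence bijective in finite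
  dimension, and the stationary point exists. Second, the difference \<open>v\<close> between a solution and the
  stationary point obeys \<open>v' = \<i> A v - a v\<close>, whose skew part \<open>\<i> A\<close> does not contribute to the derivative
  of \<open>\<parallel>v\<parallel>\<^sup>2\<close>; therefore \<open>\<parallel>v\<parallel>\<^sup>2\<close> decays exactly like \<open>exp (- 2 a t)\<close> and the inner limit is \<open>w\<close>.
  Third, the minimal-norm solution, being orthogonal to the null space, lies in the range of the selfadjoint \<open>A\<close>:
  \<open>y = A z\<close>. Then \<open>(A + \<i>a) (x - y + \<i>a z) = - a\<^sup>2 z\<close>, and the lower bound yields
  \<open>\<parallel>x - y\<parallel> \<le> 2 a \<parallel>z\<parallel>\<close>, which tends to \<open>0\<close> with \<open>a\<close>.\<close>

lemma inner_eq_Re_cinner: "inner x y = Re (cinner x y)"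
  by (simp add: inner_vec_def cinner_def inner_complex_def)

lemma of_real_vector_scalar_mult: "of_real r *s (x :: complex ^ 'n) = r *\<^sub>R x"
  by (simp add: vec_eq_iff scaleR_conv_of_real[where 'a = complex])

lemma inner_imaginary_skew:
  fixes x y :: "complex ^ 'n"
  shows "inner (\<i> *s x) y = - inner x (\<i> *s y)"
  unfolding inner_vec_def sum_negf[symmetric]
  by (intro sum.cong) (simp_all add: inner_complex_def)

lemma norm_imaginary_mult: "norm (\<i> *s (x :: complex ^ 'n)) = norm x"
  by (simp add: norm_vec_def norm_mult)

lemma bounded_linear_imaginary_mult: "bounded_linear (\<lambda>x :: complex ^ 'n. \<i> *s x)"
  by (rule bounded_linear_intro[where K = 1])
    (simp_all add: norm_imaginary_mult vector_add_ldistrib vec_eq_iff scaleR_conv_of_real[where 'a = complex])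

lemma linear_vector_scalar_mult_imp_linear:
  fixes A :: "complex ^ 'n \<Rightarrow> complex ^ 'm"
  assumes "Vector_Spaces.linear (*s) (*s) A"
  shows "linear A"
proof -
  interpret Vector_Spaces.linear "(*s)" "(*s)" A by fact
  show ?thesis
    by (rule linearI) (simp_all add: add scale flip: of_real_vector_scalar_mult)
qed

lemma selfadjoint_imp_linear: "selfadjoint A \<Longrightarrow> linear A"
  by (simp add: selfadjoint_def linear_vector_scalar_mult_imp_linear)

lemma selfadjoint_imaginary_mult:
  assumes "selfadjoint A"
  shows "A (\<i> *s x) = \<i> *s A x"
proof -
  interpret Vector_Spaces.linear "(*s)" "(*s)" A
    using assms by (simp add: selfadjoint_def)
  show ?thesis by (rule scale)
qed

lemma selfadjoint_inner:
  assumes "selfadjoint A"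
  shows "inner (A x) y = inner x (A y)"
  using assms by (simp add: inner_eq_Re_cinner selfadjoint_def)

text \<open>Moving \<open>A\<close> and then \<open>\<i>\<close> from one factor to the other turns the inner product into its negative.\<close>

lemma selfadjoint_inner_imaginary:
  assumes "selfadjoint A"
  shows "inner (A x) (\<i> *s x) = 0"
proof -
  have "inner (A x) (\<i> *s x) = inner x (\<i> *s A x)"
    by (simp add: selfadjoint_inner[OF assms] selfadjoint_imaginary_mult[OF assms])
  also have "\<dots> = - inner (A x) (\<i> *s x)"
    using inner_imaginary_skew[of x "A x"] by (simp add: inner_commute)
  finally show ?thesis by simp
qed

lemma selfadjoint_shift_lower_bound:
  assumes "selfadjoint A" and "a > 0"
  shows "a * norm x \<le> norm (A x + a *\<^sub>R (\<i> *s x))"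
proof (rule power2_le_imp_le)
  have "(norm (A x + a *\<^sub>R (\<i> *s x)))\<^sup>2 = (norm (A x))\<^sup>2 + (norm (a *\<^sub>R (\<i> *s x)))\<^sup>2"
    by (rule norm_add_Pythagorean)
      (simp add: orthogonal_def selfadjoint_inner_imaginary[OF assms(1)])
  then show "(a * norm x)\<^sup>2 \<le> (norm (A x + a *\<^sub>R (\<i> *s x)))\<^sup>2"
    by (simp add: norm_imaginary_mult power_mult_distrib)
qed simp

lemma linear_selfadjoint_shift:
  assumes "selfadjoint A"
  shows "linear (\<lambda>x. A x + a *\<^sub>R (\<i> *s x))"
  by (rule linear_compose_add[OF selfadjoint_imp_linear[OF assms]
        linear_compose_scale_right[OF bounded_linear.linear[OF bounded_linear_imaginary_mult]]])

lemma selfadjoint_shift_surj: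
  fixes A :: "complex ^ 'n \<Rightarrow> complex ^ 'n"
  assumes "selfadjoint A" and "a > 0"
  shows "surj (\<lambda>x. A x + a *\<^sub>R (\<i> *s x))"
proof (rule linear_injective_imp_surjective)
  show lin: "linear (\<lambda>x. A x + a *\<^sub>R (\<i> *s x))"
    by (rule linear_selfadjoint_shift) fact
  have "x = 0" if "A x + a *\<^sub>R (\<i> *s x) = 0" for x
    using selfadjoint_shift_lower_bound[OF assms, of x] \<open>a > 0\<close>
    unfolding that by (simp add: mult_le_0_iff)
  then show "inj (\<lambda>x. A x + a *\<^sub>R (\<i> *s x))"
    unfolding linear_injective_0[OF lin] by blast
qed simp

text \<open>The component of \<open>y\<close> orthogonal to the range of \<open>A\<close> lies in the null space, hence is orthogonal
  to \<open>y\<close> and so to itself.\<close>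

lemma selfadjoint_orthogonal_null_space_in_range:
  fixes A :: "complex ^ 'n \<Rightarrow> complex ^ 'n"
  assumes A: "selfadjoint A" and y: "\<And>z. z \<in> null_space A \<Longrightarrow> cinner y z = 0"
  shows "y \<in> range A"
proof -
  have span: "span (range A) = range A"
    by (intro span_eq_iff[THEN iffD2] linear_subspace_image selfadjoint_imp_linear A) simp
  obtain p q where p: "p \<in> range A" and q: "\<And>w. w \<in> range A \<Longrightarrow> orthogonal q w" and ypq: "y = p + q"
    using orthogonal_subspace_decomp_exists[of "range A" y] unfolding span by blast
  have "inner (A q) (A q) = 0"
    using q[of "A (A q)"] by (simp add: orthogonal_def selfadjoint_inner[OF A])
  then have "q \<in> null_space A"
    by (simp add: null_space_def)
  then have "inner y q = 0"
    by (simp add: y inner_eq_Re_cinner)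
  moreover have "inner p q = 0"
    using q[OF p] by (simp add: orthogonal_def inner_commute)
  ultimately have "q = 0"
    by (simp add: ypq inner_add_left)
  with p ypq show ?thesis by simp
qed

text \<open>Conservation of \<open>exp (2 a t) \<parallel>v t\<parallel>\<^sup>2\<close>, where \<open>v\<close> is the deviation from the stationary point.\<close>

lemma cauchy_solution_tendsto_stationary:
  fixes A :: "complex ^ 'n \<Rightarrow> complex ^ 'n"
  assumes A: "selfadjoint A" and a: "a > 0" and u: "cauchy_solution A f a u"
    and x: "A x + a *\<^sub>R (\<i> *s x) = f"
  shows "(u \<longlongrightarrow> \<i> *s x) at_top"
proof -
  define v where "v t = u t - \<i> *s x" for t
  define E where "E t = exp (2 * a * t) * inner (v t) (v t)" for t
  have diffA: "A (p - q) = A p - A q" for p q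
    by (rule linear_diff[OF selfadjoint_imp_linear[OF A]])
  have dv: "(v has_vector_derivative \<i> *s A (v t) - a *\<^sub>R v t) (at t within {0..})"
    if "t \<ge> 0" for t
  proof -
    have "(u has_vector_derivative
        \<i> *s (A (u t) + (\<i> * of_real a) *s u t) + f) (at t within {0..})"
      using u that by (simp add: cauchy_solution_def)
    moreover have "\<i> *s (A (u t) + (\<i> * of_real a) *s u t) + f = \<i> *s A (v t) - a *\<^sub>R v t"
      unfolding v_def diffA selfadjoint_imaginary_mult[OF A] x[symmetric]
      by (simp add: vec_eq_iff complex_eq_iff algebra_simps)
    ultimately show ?thesis
      unfolding v_def by (auto intro!: derivative_eq_intros)
  qed
  have "(E has_field_derivative 0) (at t within {0..})" if "t \<in> {0..}" for t
  proof -
    have skew: "inner (\<i> *s A (v t)) (v t) = 0"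
      by (simp add: inner_imaginary_skew selfadjoint_inner_imaginary[OF A])
    have dinner: "((\<lambda>t. inner (v t) (v t)) has_vector_derivative - 2 * a * inner (v t) (v t))
        (at t within {0..})"
      using bounded_bilinear.has_vector_derivative
          [OF bounded_bilinear_inner dv dv, of t] that skew
      by (simp add: inner_diff_left inner_diff_right inner_commute algebra_simps)
    show ?thesis
      unfolding E_def
      by (rule derivative_eq_intros refl
          dinner[folded has_real_derivative_iff_has_vector_derivative])+ (simp add: algebra_simps)
  qed
  then obtain C where C: "\<And>t. t \<ge> 0 \<Longrightarrow> E t = C"
    using has_field_derivative_zero_constant[of "{0..}" E] by auto
  have "((\<lambda>t. C * exp (- 2 * a * t)) \<longlongrightarrow> C * 0) at_top"
  proof (intro tendsto_mult tendsto_const)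
    show "((\<lambda>t. exp (- 2 * a * t)) \<longlongrightarrow> 0) at_top"
      using a by (intro filterlim_compose[OF exp_at_bot] filterlim_tendsto_neg_mult_at_bot
          [OF tendsto_const _ filterlim_ident]) simp
  qed
  moreover have "\<forall>\<^sub>F t in at_top. C * exp (- 2 * a * t) = (norm (v t))\<^sup>2"
    using eventually_ge_at_top[of 0]
  proof eventually_elim
    case (elim t)
    show ?case
      unfolding C[OF elim, symmetric]
      by (simp add: E_def power2_norm_eq_inner mult.left_commute flip: exp_add)
  qed
  ultimately have "((\<lambda>t. (norm (v t))\<^sup>2) \<longlongrightarrow> 0) at_top"
    by (simp add: Lim_transform_eventually)
  then have "((\<lambda>t. norm (v t)) \<longlongrightarrow> 0) at_top"
    using tendsto_real_sqrt[of "\<lambda>t. (norm (v t))\<^sup>2" 0] by simp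
  then show ?thesis
    unfolding v_def by (simp add: tendsto_norm_zero_iff LIM_zero_iff)
qed

text \<open>Error of the regularized solution, linear in \<open>a\<close>: the corrector \<open>\<i>a z\<close> cancels the residual
  \<open>- \<i>a A z\<close> to first order, which offsets the factor \<open>1 / a\<close> lost in the lower bound.\<close>

lemma selfadjoint_regularization_error:
  assumes A: "selfadjoint A" and a: "a > 0"
    and x: "A x + a *\<^sub>R (\<i> *s x) = A (A z)"
  shows "norm (x - A z) \<le> 2 * a * norm z"
proof -
  \<comment> \<open>The shifted operator maps \<open>d\<close> to \<open>- a\<^sup>2 z\<close>.\<close>
  define d where "d = x - A z + a *\<^sub>R (\<i> *s z)"
  note lin = selfadjoint_imp_linear[OF A]
  have "A d + a *\<^sub>R (\<i> *s d) =
      (A x + a *\<^sub>R (\<i> *s x)) - A (A z) - a *\<^sub>R a *\<^sub>R z"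
    unfolding d_def linear_add[OF lin] linear_diff[OF lin] linear_cmul[OF lin]
      selfadjoint_imaginary_mult[OF A]
    by (simp add: vec_eq_iff complex_eq_iff algebra_simps)
  then have "a * norm d \<le> norm (- (a *\<^sub>R a *\<^sub>R z))"
    using selfadjoint_shift_lower_bound[OF A a, of d] x by simp
  then have "norm d \<le> a * norm z"
    using a by simp
  moreover have "norm (x - A z) \<le> norm d + norm (a *\<^sub>R (\<i> *s z))"
    using norm_triangle_ineq4[of d "a *\<^sub>R (\<i> *s z)"] by (simp add: d_def)
  ultimately show ?thesis
    using a by (simp add: norm_imaginary_mult)
qed

theorem theorem1:
  fixes A :: "complex ^ 'n \<Rightarrow> complex ^ 'n"
    and f y :: "complex ^ 'n"
    and u :: "real \<Rightarrow> real \<Rightarrow> complex ^ 'n"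
  assumes "selfadjoint A"
    and "f \<in> range A"
    and "minimal_norm_solution A f y"
    and "\<And>a. a > 0 \<Longrightarrow> cauchy_solution A f a (u a)"
  shows "\<exists>L l. (\<forall>a>0. (u a \<longlongrightarrow> L a) at_top) \<and> (L \<longlongrightarrow> l) (at_right 0) \<and> (- \<i>) *s l = y"
proof -
  define x where "x a = inv (\<lambda>x. A x + a *\<^sub>R (\<i> *s x)) f" for a
  have x: "A (x a) + a *\<^sub>R (\<i> *s x a) = f" if "a > 0" for a
    using surj_f_inv_f[OF selfadjoint_shift_surj[OF assms(1) that], of f] by (simp only: x_def)
  have "y \<in> range A"
    using assms(3) by (intro selfadjoint_orthogonal_null_space_in_range assms(1))
      (simp add: minimal_norm_solution_def)
  then obtain z where z: "y = A z" by blast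
  then have f: "f = A (A z)"
    using assms(3) by (simp add: minimal_norm_solution_def)
  have "((\<lambda>a. x a - y) \<longlongrightarrow> 0) (at_right 0)"
  proof (rule Lim_null_comparison)
    show "\<forall>\<^sub>F a in at_right 0. norm (x a - y) \<le> 2 * a * norm z"
      using eventually_at_right_less[of 0]
      by eventually_elim (simp add: z x f selfadjoint_regularization_error[OF assms(1)])
    show "((\<lambda>a. 2 * a * norm z) \<longlongrightarrow> 0) (at_right 0)"
      by (auto intro!: tendsto_eq_intros)
  qed
  then have "(x \<longlongrightarrow> y) (at_right 0)"
    by (simp add: LIM_zero_iff)
  then have "((\<lambda>a. \<i> *s x a) \<longlongrightarrow> \<i> *s y) (at_right 0)"
    by (rule bounded_linear.tendsto[OF bounded_linear_imaginary_mult])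
  moreover have "(u a \<longlongrightarrow> \<i> *s x a) at_top" if "a > 0" for a
    using cauchy_solution_tendsto_stationary assms(1,4) x that by blast
  moreover have "(- \<i>) *s (\<i> *s y) = y"
    by simp
  ultimately show ?thesis
    by (intro exI[of _ "\<lambda>a. \<i> *s x a"] exI[of _ "\<i> *s y"]) simp
qed

end
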